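(* Let $S=Z(h)$ be an unstable $(2,2)$-type surface of $\mathbb{P}^1\times\mathbb{P}^2$. Then there exists $f\in G\cdot h$ such that $f$ is a linear combination of monomials of (at least) one of the sets $$M^{+}((-3,3),(-2,-2,4)),\quad M^{+}((-4,4),(-10,5,5)),\quad M^{+}((-1,1),(-3,-1,4)),\quad M^{+}((-2,2),(-5,-1,6)),$$ which are distinct subsets of $M$.
   Context: Work over $\mathbb{C}$. A $(2,2)$-type surface is an effective divisor $S=Z(h)$ of $\mathbb{P}^1\times\mathbb{P}^2$, where $0\neq h\in V=\mathbb{C}[x_0,x_1]_2\otimes\mathbb{C}[y_0,y_1,y_2]_2$. $G=\mathrm{SL}(2,\mathbb{C})\times\mathrm{SL}(3,\mathbb{C})$ acts linearly on $V$ by linear changes of the coordinates. $S=Z(h)$ is unstable if $0\in\overline{G\cdot h}$; equivalently (Hilbert–Mumford), $\lim_{t\to0}\lambda(t)\cdot h=0$ for some one-parameter subgroup $\lambda$ of $G$. $M$ is the set of monomials $x_0^{\alpha_0}x_1^{\alpha_1}y_0^{\beta_0}y_1^{\beta_1}y_2^{\beta_2}$ with $\alpha_0+\alpha_1=2$, $\beta_0+\beta_1+\beta_2=2$ (a basis of $V$). For integers with $r_0+r_1=0$, $r_0\le r_1$, $s_0+s_1+s_2=0$, $s_0\le s_1\le s_2$, $$M^{+}((r_0,r_1),(s_0,s_1,s_2))=\{x_0^{\alpha_0}x_1^{\alpha_1}y_0^{\beta_0}y_1^{\beta_1}y_2^{\beta_2}\in M\mid r_0\alpha_0+r_1\alpha_1+s_0\beta_0+s_1\beta_1+s_2\beta_2>0\}.$$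 *)

theory Defs
  imports "HOL-Analysis.Analysis"
begin

text \<open>
  The coordinates \<open>x\<^sub>0, x\<^sub>1\<close> and \<open>y\<^sub>0, y\<^sub>1, y\<^sub>2\<close> are the components of a point
  of \<open>\<complex>\<^sup>2 \<times> \<complex>\<^sup>3\<close>. Since \<open>\<complex>\<close> is infinite, polynomials are identified
  with the polynomial functions they induce on \<open>\<complex>\<^sup>2 \<times> \<complex>\<^sup>3\<close>.

  A monomial is represented by its exponent vectors \<open>(\<alpha>, \<beta>)\<close>; \<open>monomial_fun\<close>
  is the polynomial function it stands for.
\<close>

type_synonym point = "(complex^2) \<times> (complex^3)"
type_synonym monomial = "(nat^2) \<times> (nat^3)"

definition M :: "monomial set" where
  "M = {(\<alpha>, \<beta>). \<alpha>$0 + \<alpha>$1 = 2 \<and> \<beta>$0 + \<beta>$1 + \<beta>$2 = 2}"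

fun monomial_fun :: "monomial \<Rightarrow> point \<Rightarrow> complex" where
  "monomial_fun (\<alpha>, \<beta>) (x, y) =
     x$0 ^ (\<alpha>$0) * x$1 ^ (\<alpha>$1) * (y$0 ^ (\<beta>$0) * y$1 ^ (\<beta>$1) * y$2 ^ (\<beta>$2))"

text \<open>
  The linear combinations of the monomials in \<open>E\<close>, for finite \<open>E\<close>. It is used only for
  subsets of \<open>M\<close>, which is finite by \<open>finite_M\<close> below.
\<close>

definition lin_combs :: "monomial set \<Rightarrow> (point \<Rightarrow> complex) set" where
  "lin_combs E = {f. \<exists>c :: monomial \<Rightarrow> complex. f = (\<lambda>p. \<Sum>m\<in>E. c m * monomial_fun m p)}"

definition V :: "(point \<Rightarrow> complex) set" where
  "V = lin_combs M"

definition G :: "((complex^2^2) \<times> (complex^3^3)) set" where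
  "G = {(A, B). det A = 1 \<and> det B = 1}"

text \<open>
  The pair \<open>(A, B)\<close> substitutes \<open>\<Sum>\<^sub>i A\<^sub>i\<^sub>j x\<^sub>i\<close> for \<open>x\<^sub>j\<close>, and likewise \<open>B\<close> in the \<open>y\<^sub>j\<close>.
  Evaluating at row vectors times matrices makes this a left action, and a diagonal matrix with
  entries \<open>t\<^bsup>r\<^sub>i\<^esup>\<close> multiplies \<open>x\<^sub>i\<close> by \<open>t\<^bsup>r\<^sub>i\<^esup>\<close>.
\<close>

fun act :: "(complex^2^2) \<times> (complex^3^3) \<Rightarrow> (point \<Rightarrow> complex) \<Rightarrow> (point \<Rightarrow> complex)" where
  "act (A, B) h = (\<lambda>(x, y). h (x v* A, y v* B))"

definition orbit :: "(point \<Rightarrow> complex) \<Rightarrow> (point \<Rightarrow> complex) set" where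
  "orbit h = {act g h | g. g \<in> G}"

text \<open>
  The closure is taken in the topology of pointwise convergence on functions. On the
  finite-dimensional space \<open>V\<close>, which contains the orbits of its elements, this
  topology is the usual Euclidean one, that is, convergence of coefficients. For an orbit of an
  algebraic group over \<open>\<complex>\<close> the Euclidean and the Zariski closure agree.
\<close>

definition unstable :: "(point \<Rightarrow> complex) \<Rightarrow> bool" where
  "unstable h \<longleftrightarrow> (\<lambda>_. 0) \<in> closure (orbit h)"

definition Mplus :: "int \<times> int \<Rightarrow> int \<times> int \<times> int \<Rightarrow> monomial set" where
  "Mplus = (\<lambda>(r0, r1) (s0, s1, s2). {(\<alpha>, \<beta>) \<in> M.
     r0 * int (\<alpha>$0) + r1 * int (\<alpha>$1) +
     s0 * int (\<beta>$0) + s1 * int (\<beta>$1) + s2 * int (\<beta>$2) > 0})"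

lemma finite_M: "finite M"
proof -
  let ?a = "\<lambda>\<alpha> :: nat^2. (\<alpha>$0, \<alpha>$1)" and ?b = "\<lambda>\<beta> :: nat^3. (\<beta>$0, \<beta>$1, \<beta>$2)"
  have zero: "(0::2) = 2" "(0::3) = 3"
    by simp_all
  have "inj ?a" "inj ?b"
    unfolding zero by (auto simp: inj_def vec_eq_iff forall_2 forall_3)
  then have "inj_on (map_prod ?a ?b) M"
    by (meson inj_on_subset prod.inj_map subset_UNIV)
  moreover have "map_prod ?a ?b ` M \<subseteq> ({..2} \<times> {..2}) \<times> ({..2} \<times> {..2} \<times> {..2})"
    by (auto simp: M_def)
  then have "finite (map_prod ?a ?b ` M)"
    by (rule finite_subset) simp
  ultimately show ?thesis
    by (simp add: finite_image_iff)
qed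

end

theory Submission
  imports Defs
begin

text \<open>
  A function \<open>h\<close> in \<open>V\<close> is \<open>F(x, x, y, y)\<close> for a quadrilinear form \<open>F\<close> that is
  symmetric in each pair of arguments. Gaussian elimination with complete pivoting writes every
  pair \<open>g\<close> of matrices of determinant 1 as \<open>X\<^sup>-\<^sup>1 D Y\<close> with \<open>D\<close> diagonal and
  \<open>X, Y\<close> of determinant 1 with entries bounded by a constant; this is enough compactness to do
  the job of the Cartan decomposition. If \<open>g\<^sub>n \<cdot> h\<close> tends to 0 and a subsequence of
  \<open>Y\<^sub>n\<close> tends to \<open>Y\<close>, then each monomial that occurs in \<open>Y \<cdot> h\<close> is eventually
  contracted by \<open>D\<^sub>n\<close>, so minus the logarithms of the absolute values of the diagonal entries
  are real weights \<open>r, s\<close> for which the support of \<open>Y \<cdot> h\<close> is positive.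

  After sorting the weights, the positive monomials lie in the first, second or fourth set (which
  contains the third), except in two cases. If \<open>s\<^sub>1 \<ge> 0\<close> and \<open>r\<^sub>1 > s\<^sub>1 + s\<^sub>2\<close>, the
  coefficient of \<open>x\<^sub>0 x\<^sub>1\<close> is a binary form in \<open>y\<^sub>1, y\<^sub>2\<close>, which loses its
  \<open>y\<^sub>1\<close>-square after a change of basis. If \<open>s\<^sub>1 < 0\<close> and \<open>s\<^sub>0 + s\<^sub>2 > 2 r\<^sub>1\<close>, the
  variable \<open>y\<^sub>2\<close> divides the form, and the coefficient of \<open>y\<^sub>0 y\<^sub>2\<close> loses its
  \<open>x\<^sub>0\<close>-square in the same way.
\<close>

section \<open>Coordinates indexed by residues modulo 2 and 3\<close>

lemma forall_idx2: "(\<forall>i::2. P i) \<longleftrightarrow> P 0 \<and> P 1"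
proof -
  \<comment> \<open>The numeral 2 denotes the residue 0, so the indices 1, 2 of
    \<open>forall_2\<close> are 1, 0.\<close>
  have "(2::2) = 0" by simp
  then show ?thesis unfolding forall_2 by metis
qed

lemma forall_idx3: "(\<forall>i::3. P i) \<longleftrightarrow> P 0 \<and> P 1 \<and> P 2"
proof -
  have "(3::3) = 0" by simp
  then show ?thesis unfolding forall_3 by metis
qed

lemma UNIV_idx2: "(UNIV::2 set) = {0, 1}"
  by (rule UNIV_eq_I) (use forall_idx2[of "\<lambda>i. i \<in> {0, 1}"] in blast)

lemma UNIV_idx3: "(UNIV::3 set) = {0, 1, 2}"
  by (rule UNIV_eq_I) (use forall_idx3[of "\<lambda>i. i \<in> {0, 1, 2}"] in blast)

lemma sum_idx2: "(\<Sum>i\<in>UNIV. f (i::2)) = f 0 + f 1"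
  unfolding UNIV_idx2 by simp

lemma sum_idx3: "(\<Sum>i\<in>UNIV. f (i::3)) = f 0 + f 1 + f 2"
  unfolding UNIV_idx3 by (simp add: add.assoc)

lemma sum_if_const: "(\<Sum>a\<in>A. if P then g a else 0) = (if P then sum g A else 0)"
  by simp

lemma det_idx2: "det (A :: 'a::comm_ring_1^2^2) = A$0$0 * A$1$1 - A$0$1 * A$1$0"
proof -
  have two: "(2::2) = 0" by simp
  show ?thesis unfolding det_2 by (subst two)+ (simp only: mult.commute)
qed

lemma det_idx3:
  "det (A :: 'a::comm_ring_1^3^3) =
     A$0$0 * (A$1$1 * A$2$2 - A$1$2 * A$2$1)
   - A$0$1 * (A$1$0 * A$2$2 - A$1$2 * A$2$0)
   + A$0$2 * (A$1$0 * A$2$1 - A$1$1 * A$2$0)"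
proof -
  have three: "(3::3) = 0" by simp
  show ?thesis unfolding det_3 by (subst three)+ (simp only: algebra_simps)
qed

section \<open>Quadrilinear forms\<close>

definition form ::
  "('m \<Rightarrow> 'm \<Rightarrow> 'n \<Rightarrow> 'n \<Rightarrow> complex) \<Rightarrow> complex^'m::finite \<Rightarrow> complex^'m \<Rightarrow> complex^'n::finite \<Rightarrow> complex^'n \<Rightarrow> complex"
  where "form T u u' w w' =
    (\<Sum>i\<in>UNIV. \<Sum>j\<in>UNIV. \<Sum>k\<in>UNIV. \<Sum>l\<in>UNIV. T i j k l * u$i * u'$j * w$k * w'$l)"

definition sym_tensor :: "('m \<Rightarrow> 'm \<Rightarrow> 'n \<Rightarrow> 'n \<Rightarrow> complex) \<Rightarrow> bool" where
  "sym_tensor T \<longleftrightarrow> (\<forall>i j k l. T i j k l = T j i k l \<and> T i j k l = T i j l k)"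

text \<open>Rows enter because \<open>act\<close> multiplies row vectors by matrices; by
  \<open>form_sub_tensor\<close> this is the coefficient array of the transformed function.\<close>

definition sub_tensor ::
  "('m \<Rightarrow> 'm \<Rightarrow> 'n \<Rightarrow> 'n \<Rightarrow> complex) \<Rightarrow> complex^'m::finite^'m \<Rightarrow> complex^'n::finite^'n \<Rightarrow>
   ('m \<Rightarrow> 'm \<Rightarrow> 'n \<Rightarrow> 'n \<Rightarrow> complex)" where
  "sub_tensor T A B = (\<lambda>i j k l. form T (A$i) (A$j) (B$k) (B$l))"

definition tensor_fun ::
  "('m \<Rightarrow> 'm \<Rightarrow> 'n \<Rightarrow> 'n \<Rightarrow> complex) \<Rightarrow> (complex^'m::finite) \<times> (complex^'n::finite) \<Rightarrow> complex" where
  "tensor_fun T = (\<lambda>(x, y). form T x x y y)"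

lemma form_add:
  "form T (u + v) u' w w' = form T u u' w w' + form T v u' w w'"
  "form T u (u' + v) w w' = form T u u' w w' + form T u v w w'"
  "form T u u' (w + z) w' = form T u u' w w' + form T u u' z w'"
  "form T u u' w (w' + z) = form T u u' w w' + form T u u' w z"
  by (simp_all add: form_def algebra_simps sum.distrib)

lemma form_scale:
  "form T (c *s u) u' w w' = c * form T u u' w w'"
  "form T u (c *s u') w w' = c * form T u u' w w'"
  "form T u u' (c *s w) w' = c * form T u u' w w'"
  "form T u u' w (c *s w') = c * form T u u' w w'"
  by (simp_all add: form_def sum_distrib_left ac_simps)

lemma form_zero:
  "form T 0 u' w w' = 0" "form T u 0 w w' = 0" "form T u u' 0 w' = 0" "form T u u' w 0 = 0"
  by (simp_all add: form_def)

lemma form_sum: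
  assumes "finite I"
  shows
  "form T (\<Sum>a\<in>I. c a *s p a) u' w w' = (\<Sum>a\<in>I. c a * form T (p a) u' w w')"
  "form T u (\<Sum>a\<in>I. c a *s p a) w w' = (\<Sum>a\<in>I. c a * form T u (p a) w w')"
  "form T u u' (\<Sum>a\<in>I. c a *s q a) w' = (\<Sum>a\<in>I. c a * form T u u' (q a) w')"
  "form T u u' w (\<Sum>a\<in>I. c a *s q a) = (\<Sum>a\<in>I. c a * form T u u' w (q a))"
  using assms by (induction I) (simp_all add: form_add form_scale form_zero)

lemma vector_matrix_mult_rows: "x v* A = (\<Sum>i\<in>UNIV. x$i *s A$i)"
  for x :: "complex^'n"
  by (simp add: vec_eq_iff vector_matrix_mult_def mult.commute)

lemma form_sub_tensor:
  "form T (u v* A) (u' v* A) (w v* B) (w' v* B) = form (sub_tensor T A B) u u' w w'"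
  unfolding vector_matrix_mult_rows form_def[of "sub_tensor T A B"]
  \<comment> \<open>The arguments are expanded one at a time, from first to last, so that the sums
    come out nested as in \<open>form_def\<close>.\<close>
  by (simp only: form_sum(1)[OF finite_class.finite_UNIV], simp only: form_sum(2)[OF finite_class.finite_UNIV],
      simp only: form_sum(3)[OF finite_class.finite_UNIV], simp only: form_sum(4)[OF finite_class.finite_UNIV])
    (simp add: sub_tensor_def sum_distrib_left ac_simps)

lemma matrix_mult_row: "(A ** B)$i = A$i v* B"
  by (simp add: vec_eq_iff vector_matrix_mult_def matrix_matrix_mult_def mult.commute)

text \<open>The rows of \<open>C ** A\<close> are the rows of \<open>C\<close> multiplied by
  \<open>A\<close>, so \<open>form_sub_tensor\<close> applies; the right-hand factors are
  substituted into \<open>T\<close> first.\<close>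

lemma sub_tensor_mult:
  "sub_tensor T (C ** A) (D ** B) = sub_tensor (sub_tensor T A B) C D"
  unfolding sub_tensor_def[of _ "C ** A"] sub_tensor_def[of _ C] matrix_mult_row form_sub_tensor ..

lemma form_swap:
  "form (\<lambda>i j k l. T j i k l) u u' w w' = form T u' u w w'"
  "form (\<lambda>i j k l. T i j l k) u u' w w' = form T u u' w' w"
proof -
  have "form (\<lambda>i j k l. T j i k l) u u' w w' =
      (\<Sum>j\<in>UNIV. \<Sum>i\<in>UNIV. \<Sum>k\<in>UNIV. \<Sum>l\<in>UNIV. T j i k l * u$i * u'$j * w$k * w'$l)"
    unfolding form_def by (rule sum.swap)
  also have "\<dots> = form T u' u w w'"
    unfolding form_def by (intro sum.cong refl) (simp only: ac_simps)
  finally show "form (\<lambda>i j k l. T j i k l) u u' w w' = form T u' u w w'" .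
  have "form (\<lambda>i j k l. T i j l k) u u' w w' =
      (\<Sum>i\<in>UNIV. \<Sum>j\<in>UNIV. \<Sum>l\<in>UNIV. \<Sum>k\<in>UNIV. T i j l k * u$i * u'$j * w$k * w'$l)"
    unfolding form_def by (rule sum.cong[OF refl], rule sum.cong[OF refl], rule sum.swap)
  also have "\<dots> = form T u u' w' w"
    unfolding form_def by (intro sum.cong refl) (simp only: ac_simps)
  finally show "form (\<lambda>i j k l. T i j l k) u u' w w' = form T u u' w' w" .
qed

lemma form_sym:
  assumes "sym_tensor T"
  shows "form T u u' w w' = form T u' u w w'" "form T u u' w w' = form T u u' w' w"
proof -
  have "(\<lambda>i j k l. T j i k l) = T" "(\<lambda>i j k l. T i j l k) = T"
    using assms unfolding sym_tensor_def fun_eq_iff by (metis, metis)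
  then show "form T u u' w w' = form T u' u w w'" "form T u u' w w' = form T u u' w' w"
    using form_swap(1)[of T u u'] form_swap(2)[of T u u' w w'] by simp_all
qed

lemma sym_sub_tensor:
  assumes "sym_tensor T"
  shows "sym_tensor (sub_tensor T A B)"
  unfolding sym_tensor_def sub_tensor_def by (intro allI conjI form_sym assms)

text \<open>Polarisation in \<open>u, u'\<close> and again in \<open>w, w'\<close>: each contributes
  a factor 2, and the nine terms combine the three terms of each. It recovers single coefficients
  from values of the function.\<close>

lemma form_polarization:
  assumes "sym_tensor T"
  defines "q \<equiv> tensor_fun T"
  shows "4 * form T u u' w w' =
      q (u + u', w + w') - q (u + u', w) - q (u + u', w')
    - q (u, w + w') + q (u, w) + q (u, w')
    - q (u', w + w') + q (u', w) + q (u', w')"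
proof -
  note sym = form_sym[OF assms(1)]
  have "form T u' u w w' = form T u u' w w'" by (rule sym)
  moreover have "form T u u' w' w = form T u u' w w'" by (rule sym)
  moreover have "form T u' u w' w = form T u u' w w'"
    unfolding sym(1)[of u'] by (rule sym)
  ultimately show ?thesis
    by (simp add: q_def tensor_fun_def form_add algebra_simps)
qed

lemma form_axis: "form T (axis i 1) (axis j 1) (axis k 1) (axis l 1) = T i j k l"
  by (simp add: form_def axis_def if_distrib[of "\<lambda>x. x * _"] if_distrib[of "\<lambda>x. _ * x"] cong: if_cong)

lemma tendsto_form:
  assumes "(u \<longlongrightarrow> u0) F" "(u' \<longlongrightarrow> u0') F" "(w \<longlongrightarrow> w0) F" "(w' \<longlongrightarrow> w0') F"
  shows "((\<lambda>n. form T (u n) (u' n) (w n) (w' n)) \<longlongrightarrow> form T u0 u0' w0 w0') F"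
  unfolding form_def by (intro tendsto_intros assms)

lemma norm_form_le:
  fixes u u' :: "complex^'m" and w w' :: "complex^'n"
  assumes "\<And>i j k l. norm (T i j k l) \<le> e"
    and "\<And>i. norm (u$i) \<le> C" "\<And>i. norm (u'$i) \<le> C" "\<And>i. norm (w$i) \<le> C" "\<And>i. norm (w'$i) \<le> C"
  shows "norm (form T u u' w w') \<le> (real CARD('m))\<^sup>2 * (real CARD('n))\<^sup>2 * C ^ 4 * e"
proof -
  have C: "C \<ge> 0" using assms(2) norm_ge_zero order_trans by blast
  have e: "e \<ge> 0" using assms(1) norm_ge_zero order_trans by blast
  have "norm (T i j k l * u$i * u'$j * w$k * w'$l) \<le> e * C * C * C * C" for i j k l
    unfolding norm_mult by (intro mult_mono assms mult_nonneg_nonneg norm_ge_zero C e)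
  then have "norm (form T u u' w w') \<le> (\<Sum>i\<in>(UNIV::'m set). \<Sum>j\<in>(UNIV::'m set). \<Sum>k\<in>(UNIV::'n set). \<Sum>l\<in>(UNIV::'n set). e * C * C * C * C)"
    unfolding form_def by (intro sum_norm_le)
  then show ?thesis
    by (simp add: power2_eq_square power4_eq_xxxx ac_simps)
qed

section \<open>Diagonalisation by bounded unimodular matrices\<close>

text \<open>One elimination step with an entry of largest modulus as pivot. All multipliers are
  quotients by the pivot, hence of modulus at most 1; signed swaps of rows or columns keep the
  determinants 1.\<close>

lemma bounded_diagonalisation2:
  fixes A :: "complex^2^2"
  shows "\<exists>X Y d. det X = 1 \<and> det Y = 1 \<and>
    (\<forall>i j. norm (X$i$j) \<le> 1) \<and> (\<forall>i j. norm (Y$i$j) \<le> 1) \<and>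
    X ** A = (\<chi> i. d i *s Y$i)"
proof -
  define p q r s where "p = A$0$0" and "q = A$0$1" and "r = A$1$0" and "s = A$1$1"
  define M2 :: "complex \<Rightarrow> complex \<Rightarrow> complex \<Rightarrow> complex \<Rightarrow> complex^2^2" where
    "M2 = (\<lambda>a b c d. \<chi> i j. if i = 0 then if j = 0 then a else b else if j = 0 then c else d)"
  define D :: "complex \<Rightarrow> complex \<Rightarrow> 2 \<Rightarrow> complex" where "D = (\<lambda>a b i. if i = 0 then a else b)"
  note defs = M2_def D_def det_idx2 forall_idx2 vec_eq_iff matrix_matrix_mult_def sum_idx2
    p_def[symmetric] q_def[symmetric] r_def[symmetric] s_def[symmetric] norm_divide
  have le: "norm (x / y) \<le> 1" if "norm x \<le> norm y" for x y :: complex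
    using that by (cases "y = 0") (auto simp: norm_divide divide_simps)
  consider
      "norm q \<le> norm p" "norm r \<le> norm p" "norm s \<le> norm p"
    | "norm p \<le> norm q" "norm r \<le> norm q" "norm s \<le> norm q"
    | "norm p \<le> norm r" "norm q \<le> norm r" "norm s \<le> norm r"
    | "norm p \<le> norm s" "norm q \<le> norm s" "norm r \<le> norm s"
    by linarith
  then show ?thesis
  proof cases
    case 1
    \<comment> \<open>A zero pivot forces the whole matrix to vanish; the quotients are then 0 by
      the convention for division by 0, and the witnesses remain unimodular.\<close>
    then have "p = 0 \<longrightarrow> q = 0 \<and> r = 0 \<and> s = 0" by auto
    then show ?thesis using 1[THEN le]
      by (intro exI[of _ "M2 1 0 (- (r / p)) 1"] exI[of _ "M2 1 (q / p) 0 1"] exI[of _ "D p (s - r * q / p)"])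
        (auto simp: defs)
  next
    case 2
    then have "q = 0 \<longrightarrow> p = 0 \<and> r = 0 \<and> s = 0" by auto
    then show ?thesis using 2[THEN le]
      by (intro exI[of _ "M2 1 0 (- (s / q)) 1"] exI[of _ "M2 (p / q) 1 (-1) 0"] exI[of _ "D q (s * p / q - r)"])
        (auto simp: defs)
  next
    case 3
    then have "r = 0 \<longrightarrow> p = 0 \<and> q = 0 \<and> s = 0" by auto
    then show ?thesis using 3[THEN le]
      by (intro exI[of _ "M2 0 1 (-1) (p / r)"] exI[of _ "M2 1 (s / r) 0 1"] exI[of _ "D r (p * s / r - q)"])
        (auto simp: defs)
  next
    case 4
    then have "s = 0 \<longrightarrow> p = 0 \<and> q = 0 \<and> r = 0" by auto
    then show ?thesis using 4[THEN le]
      by (intro exI[of _ "M2 0 1 (-1) (q / s)"] exI[of _ "M2 (r / s) 1 (-1) 0"] exI[of _ "D s (p - q * r / s)"])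
        (auto simp: defs)
  qed
qed

lemma norm_matrix_mult_le:
  fixes X :: "complex^'n^'m" and Y :: "complex^'k^'n"
  assumes "\<And>i j. norm (X$i$j) \<le> C" "\<And>i j. norm (Y$i$j) \<le> D"
  shows "norm ((X ** Y)$i$j) \<le> real CARD('n) * (C * D)"
proof -
  have "C \<ge> 0" using assms(1) norm_ge_zero order_trans by blast
  then have "norm ((X ** Y)$i$j) \<le> (\<Sum>k\<in>(UNIV::'n set). C * D)"
    unfolding matrix_matrix_mult_def vec_lambda_beta
    by (intro sum_norm_le) (simp add: norm_mult mult_mono' assms)
  then show ?thesis by simp
qed

text \<open>Cyclic shifts of rows and columns bring an entry of largest modulus to the corner; on
  three indices they are even, so no signs arise. One elimination step leaves a 2 by 2 block for
  \<open>bounded_diagonalisation2\<close>. The bound 9 = 3 * 3 comes from multiplying three 3 by 3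
  matrices with entries of modulus at most 1.\<close>

lemma bounded_diagonalisation3:
  fixes A :: "complex^3^3"
  shows "\<exists>X Y d. det X = 1 \<and> det Y = 1 \<and>
    (\<forall>i j. norm (X$i$j) \<le> 9) \<and> (\<forall>i j. norm (Y$i$j) \<le> 9) \<and>
    X ** A = (\<chi> i. d i *s Y$i)"
proof -
  obtain i0 j0 where max: "norm (A$i$j) \<le> norm (A$i0$j0)" for i j
  proof -
    define f where "f = (\<lambda>m. norm (A $ fst m $ snd m))"
    have "Max (range f) \<in> range f" by (intro Max_in) auto
    then obtain m where "f m = Max (range f)" by (metis imageE)
    then have "f m' \<le> f m" for m' by simp
    then have "norm (A$i$j) \<le> norm (A $ fst m $ snd m)" for i j unfolding f_def by (metis fst_conv snd_conv)
    then show thesis using that by blast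
  qed
  \<comment> \<open>Indices are added modulo 3, so \<open>P m\<close> is the matrix of a cyclic
    shift.\<close>
  define A' :: "complex^3^3" where "A' = (\<chi> i j. A$(i0 + i)$(j0 + j))"
  define P :: "3 \<Rightarrow> complex^3^3" where "P = (\<lambda>m. \<chi> i j. if j = m + i then 1 else 0)"
  define a where "a = A'$0$0"
  have max': "norm (A'$i$j) \<le> norm a" for i j
    using max by (simp add: A'_def a_def)
  have a0: "A'$i$j = 0" if "a = 0" for i j
    using max'[of i j] that by simp
  have detP: "det (P m) = 1" for m
    using forall_idx3[of "\<lambda>m. det (P m) = 1"] by (simp add: P_def det_idx3)
  have normP: "norm (P m $ i $ j) \<le> 1" for m i j
    by (simp add: P_def)
  have shift: "(\<Sum>k\<in>(UNIV::3 set). if j = j0 + k then f k else 0) = f (j - j0)" for j and f :: "3 \<Rightarrow> complex"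
  proof -
    have "j = j0 + k \<longleftrightarrow> k = j - j0" for k by (auto simp: algebra_simps)
    then show ?thesis by simp
  qed
  have PA: "P i0 ** A = A' ** P j0"
    by (simp add: vec_eq_iff matrix_matrix_mult_def P_def A'_def if_distrib[of "\<lambda>x. x * _"]
        if_distrib[of "\<lambda>x. _ * x"] shift cong: if_cong)
  define l u where "l = (\<lambda>i. A'$i$0 / a)" and "u = (\<lambda>j. A'$0$j / a)"
  define L U :: "complex^3^3" where
    "L = (\<chi> i j. if i = j then 1 else if j = 0 then - l i else 0)" and
    "U = (\<chi> i j. if i = j then 1 else if i = 0 then u j else 0)"
  have lu: "norm (l i) \<le> 1" "norm (u i) \<le> 1" for i
    using max' by (cases "a = 0"; simp add: l_def u_def norm_divide divide_simps)+
  define blk :: "complex \<Rightarrow> complex^2^2 \<Rightarrow> complex^3^3" where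
    "blk = (\<lambda>c S. \<chi> i j. if i = 0 then if j = 0 then c else 0 else if j = 0 then 0
        else S $ (if i = 1 then 0 else 1) $ (if j = 1 then 0 else 1))"
  \<comment> \<open>The Schur complement of the pivot; the bounds of the 2 by 2 result hold whatever
    its size.\<close>
  define S :: "complex^2^2" where
    "S = (\<chi> i j. A'$(if i = 0 then 1 else 2)$(if j = 0 then 1 else 2)
          - l (if i = 0 then 1 else 2) * A'$0$(if j = 0 then 1 else 2))"
  \<comment> \<open>For \<open>a = 0\<close> both sides vanish, since maximality makes
    \<open>A'\<close> zero.\<close>
  have ua: "a * u j = A'$0$j" "l j * a = A'$j$0" for j
    using a0 by (cases "a = 0"; simp add: u_def l_def)+
  have LA: "L ** A' = blk a S ** U"
    by (simp add: vec_eq_iff forall_idx3 matrix_matrix_mult_def sum_idx3 L_def U_def blk_def S_def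
        ua a_def[symmetric])
  obtain X2 Y2 d2 where XY2: "det X2 = 1" "det Y2 = 1" "\<forall>i j. norm (X2$i$j) \<le> 1"
      "\<forall>i j. norm (Y2$i$j) \<le> 1" "X2 ** S = (\<chi> i. d2 i *s Y2$i)"
    using bounded_diagonalisation2 by blast
  define d :: "3 \<Rightarrow> complex" where "d = (\<lambda>i. if i = 0 then a else d2 (if i = 1 then 0 else 1))"
  have X2S: "X2$i$0 * S$0$j + X2$i$1 * S$1$j = d2 i * Y2$i$j" for i j
    using XY2(5) by (simp add: vec_eq_iff matrix_matrix_mult_def sum_idx2)
  have B: "blk 1 X2 ** blk a S = (\<chi> i j. if i = j then d i else 0) ** blk 1 Y2"
    by (simp add: vec_eq_iff forall_idx3 matrix_matrix_mult_def sum_idx3 blk_def d_def X2S)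
  have detL: "det L = 1" "det U = 1"
    by (simp_all add: L_def U_def det_idx3)
  have detB: "det (blk 1 X2) = 1" "det (blk 1 Y2) = 1"
    using XY2(1,2) by (simp_all add: det_idx2 det_idx3 blk_def)
  have normL: "norm (L$i$j) \<le> 1" "norm (U$i$j) \<le> 1" for i j
    using lu by (simp_all add: L_def U_def)
  have normB: "norm (blk 1 X2$i$j) \<le> 1" "norm (blk 1 Y2$i$j) \<le> 1" for i j
    using XY2(3,4) by (simp_all add: blk_def)
  define X Y where "X = blk 1 X2 ** (L ** P i0)" and "Y = blk 1 Y2 ** (U ** P j0)"
  have "X ** A = blk 1 X2 ** (L ** A') ** P j0"
    by (simp add: X_def matrix_mul_assoc[symmetric] PA)
  also have "\<dots> = (\<chi> i j. if i = j then d i else 0) ** Y"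
    by (simp add: LA matrix_mul_assoc B) (simp add: Y_def matrix_mul_assoc)
  also have "\<dots> = (\<chi> i. d i *s Y$i)"
    by (simp add: vec_eq_iff matrix_matrix_mult_def if_distrib[of "\<lambda>x. x * _"] cong: if_cong)
  finally have "X ** A = (\<chi> i. d i *s Y$i)" .
  moreover have "det X = 1" "det Y = 1"
    by (simp_all add: X_def Y_def det_mul detB detL detP)
  moreover have "norm (X$i$j) \<le> 9" "norm (Y$i$j) \<le> 9" for i j
    using norm_matrix_mult_le[OF normB(1) norm_matrix_mult_le[OF normL(1) normP], of i0 i j]
      norm_matrix_mult_le[OF normB(2) norm_matrix_mult_le[OF normL(2) normP], of j0 i j]
    by (simp_all add: X_def Y_def)
  ultimately show ?thesis by blast
qed

section \<open>Convergence along the orbit\<close>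

lemma axis_vector_matrix_mult: "axis i 1 v* A = A$i" for A :: "complex^'n^'m"
  by (simp add: vector_matrix_mult_rows vec_eq_iff axis_def if_distrib[of "\<lambda>x. x * _"] cong: if_cong)

text \<open>A basic neighbourhood of 0 for pointwise convergence controls only finitely many values.
  By polarisation, the values at basis vectors and at sums of two of them already bound every
  coefficient.\<close>

lemma unstable_imp_small_sub_tensor:
  assumes T: "sym_tensor T" and unst: "unstable (tensor_fun T)" and "\<epsilon> > 0"
  shows "\<exists>A B. det A = 1 \<and> det B = 1 \<and> (\<forall>i j k l. norm (sub_tensor T A B i j k l) < \<epsilon>)"
proof -
  define q where "q = tensor_fun T"
  define E2 :: "(complex^2) set" where "E2 = (\<Union>i. \<Union>j. {axis i 1, axis i 1 + axis j 1})"
  define E3 :: "(complex^3) set" where "E3 = (\<Union>i. \<Union>j. {axis i 1, axis i 1 + axis j 1})"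
  \<comment> \<open>Nine values below \<open>\<epsilon> / 3\<close> add up to less than
    \<open>3 * \<epsilon>\<close>, and polarisation divides by 4.\<close>
  define U :: "(point \<Rightarrow> complex) set" where "U = {f. \<forall>p\<in>E2 \<times> E3. norm (f p) < \<epsilon> / 3}"
  have "U = (\<Inter>p\<in>E2 \<times> E3. (\<lambda>f. f p) -` ball 0 (\<epsilon> / 3))"
    by (auto simp: U_def)
  moreover have "finite (E2 \<times> E3)" by (simp add: E2_def E3_def)
  moreover have "open ((\<lambda>f::point \<Rightarrow> complex. f p) -` ball 0 (\<epsilon> / 3))" for p
    by (rule open_vimage[OF open_ball continuous_on_product_coordinates])
  ultimately have "open U" by (metis (no_types, lifting) open_INT)
  moreover have "(\<lambda>_. 0) \<in> U" using \<open>\<epsilon> > 0\<close> by (simp add: U_def)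
  ultimately have "orbit q \<inter> U \<noteq> {}"
    using unst[unfolded unstable_def closure_iff_nhds_not_empty, rule_format, of U U]
    by (simp add: q_def)
  then obtain A B where G: "det A = 1" "det B = 1" and U: "act (A, B) q \<in> U"
    by (auto simp: orbit_def G_def)
  have small: "norm (q (x v* A, y v* B)) < \<epsilon> / 3" if "x \<in> E2" "y \<in> E3" for x y
    using U that by (auto simp: U_def)
  have E: "axis i 1 \<in> E2" "axis i 1 + axis j 1 \<in> E2" "axis k 1 \<in> E3" "axis k 1 + axis l 1 \<in> E3" for i j k l
    by (auto simp: E2_def E3_def)
  have "norm (sub_tensor T A B i j k l) < \<epsilon>" for i j k l
  proof -
    have q1: "norm (q (A$i, B$k)) < \<epsilon> / 3" for i k
      using small[of "axis i 1" "axis k 1"] by (simp add: axis_vector_matrix_mult E)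
    have q2: "norm (q (A$i + A$j, B$k)) < \<epsilon> / 3" for k
      using small[of "axis i 1 + axis j 1" "axis k 1"]
      by (simp add: axis_vector_matrix_mult vector_matrix_left_distrib E)
    have q3: "norm (q (A$i, B$k + B$l)) < \<epsilon> / 3" for i
      using small[of "axis i 1" "axis k 1 + axis l 1"]
      by (simp add: axis_vector_matrix_mult vector_matrix_left_distrib E)
    have q4: "norm (q (A$i + A$j, B$k + B$l)) < \<epsilon> / 3"
      using small[of "axis i 1 + axis j 1" "axis k 1 + axis l 1"]
      by (simp add: axis_vector_matrix_mult vector_matrix_left_distrib E)
    have "norm (4 * sub_tensor T A B i j k l) \<le>
        norm (q (A$i + A$j, B$k + B$l)) + norm (q (A$i + A$j, B$k)) + norm (q (A$i + A$j, B$l))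
      + norm (q (A$i, B$k + B$l)) + norm (q (A$i, B$k)) + norm (q (A$i, B$l))
      + norm (q (A$j, B$k + B$l)) + norm (q (A$j, B$k)) + norm (q (A$j, B$l))"
      unfolding sub_tensor_def form_polarization[OF T] q_def[symmetric]
      by (intro order_trans[OF norm_triangle_ineq] order_trans[OF norm_triangle_ineq4] add_mono order_refl)
    then show ?thesis
      using q4 q2[of k] q2[of l] q3[of i] q3[of j] q1[of i k] q1[of i l] q1[of j k] q1[of j l] \<open>\<epsilon> > 0\<close>
      by (simp add: norm_mult)
  qed
  then show ?thesis using G by blast
qed

lemma norm_vec_le_card_mult:
  fixes x :: "'a::real_normed_vector^'n"
  assumes "\<And>i. norm (x$i) \<le> c"
  shows "norm x \<le> real CARD('n) * c"
  unfolding norm_vec_def using L2_set_le_sum[of UNIV "\<lambda>i. norm (x$i)"]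
    sum_mono[of UNIV "\<lambda>i. norm (x$i)" "\<lambda>_. c"] assms by simp

lemma bounded_range_matrix:
  fixes F :: "'k \<Rightarrow> complex^'n^'m"
  assumes "\<And>a i j. norm (F a $ i $ j) \<le> c"
  shows "bounded (range F)"
proof (rule boundedI)
  fix m assume "m \<in> range F"
  then have "norm (m$i$j) \<le> c" for i j using assms by auto
  then show "norm m \<le> real CARD('m) * (real CARD('n) * c)"
    by (intro norm_vec_le_card_mult)
qed

text \<open>A Hilbert-Mumford criterion with real weights. Integrality is not asked for, because the
  weights are later only compared through linear inequalities.\<close>

lemma destabilising_weights:
  fixes T :: "2 \<Rightarrow> 2 \<Rightarrow> 3 \<Rightarrow> 3 \<Rightarrow> complex"
  assumes T: "sym_tensor T" and unst: "unstable (tensor_fun T)"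
  shows "\<exists>Y Z (r :: 2 \<Rightarrow> real) (s :: 3 \<Rightarrow> real). det Y = 1 \<and> det Z = 1 \<and>
    r 0 + r 1 = 0 \<and> s 0 + s 1 + s 2 = 0 \<and>
    (\<forall>i j k l. sub_tensor T Y Z i j k l \<noteq> 0 \<longrightarrow> r i + r j + s k + s l > 0)"
proof -
  define C :: real where "C = 9"
  \<comment> \<open>\<open>P n\<close> collects diagonal entries \<open>d, e\<close> and right
    factors \<open>Y, Z\<close> for a pair whose coefficients are below \<open>1 / Suc n\<close>.
    The 36 counts index quadruples, and \<open>C ^ 4\<close> accounts for the entries of the left
    factors.\<close>
  define P where "P = (\<lambda>(n::nat) (Y, Z, d, e).
    det (Y :: complex^2^2) = 1 \<and> det (Z :: complex^3^3) = 1 \<and> (\<forall>i j. norm (Y$i$j) \<le> C) \<and> (\<forall>i j. norm (Z$i$j) \<le> C) \<and>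
    d 0 * d 1 = 1 \<and> e 0 * e 1 * e 2 = 1 \<and>
    (\<forall>i j k l. norm (d i * d j * e k * e l * sub_tensor T Y Z i j k l) \<le> 36 * C ^ 4 * (1 / Suc n)))"
  have "\<exists>p. P n p" for n
  proof -
    obtain A B where AB: "det A = 1" "det B = 1"
      "\<And>i j k l. norm (sub_tensor T A B i j k l) < 1 / Suc n"
      using unstable_imp_small_sub_tensor[OF T unst, of "1 / Suc n"] by auto
    obtain X Y d where X: "det X = 1" "det Y = 1" "\<forall>i j. norm (X$i$j) \<le> 1" "\<forall>i j. norm (Y$i$j) \<le> 1"
      "X ** A = (\<chi> i. d i *s Y$i)"
      using bounded_diagonalisation2 by blast
    obtain W Z e where W: "det W = 1" "det Z = 1" "\<forall>i j. norm (W$i$j) \<le> C" "\<forall>i j. norm (Z$i$j) \<le> C"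
      "W ** B = (\<chi> i. e i *s Z$i)"
      using bounded_diagonalisation3 unfolding C_def by blast
    have "d 0 * d 1 * det Y = det (X ** A)" unfolding X(5) by (simp add: det_idx2 algebra_simps)
    then have "d 0 * d 1 = 1" unfolding det_mul X(1,2) AB by simp
    moreover have "e 0 * e 1 * e 2 * det Z = det (W ** B)" unfolding W(5) by (simp add: det_idx3 algebra_simps)
    then have "e 0 * e 1 * e 2 = 1" unfolding det_mul W(1,2) AB by simp
    moreover have "norm (d i * d j * e k * e l * sub_tensor T Y Z i j k l) \<le> 36 * C ^ 4 * (1 / Suc n)" for i j k l
    proof -
      \<comment> \<open>The coefficients for \<open>X ** A, W ** B\<close> are computed twice:
        through the diagonal they are multiples of those for \<open>Y, Z\<close>; through
        \<open>A, B\<close> they are small, since \<open>X, W\<close> are bounded.\<close>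
      have "d i * d j * e k * e l * sub_tensor T Y Z i j k l = sub_tensor T (X ** A) (W ** B) i j k l"
        unfolding X(5) W(5) by (simp add: sub_tensor_def form_scale)
      also have "\<dots> = form (sub_tensor T A B) (X$i) (X$j) (W$k) (W$l)"
        unfolding sub_tensor_mult by (simp add: sub_tensor_def)
      also have "norm \<dots> \<le> (real CARD(2))\<^sup>2 * (real CARD(3))\<^sup>2 * C ^ 4 * (1 / Suc n)"
        using X(3) W(3) AB(3) by (intro norm_form_le) (auto simp: C_def less_imp_le intro: order_trans[of _ 1])
      finally show ?thesis by simp
    qed
    ultimately have "P n (Y, Z, d, e)"
      using X W AB by (auto simp: P_def C_def intro: order_trans[of _ 1])
    then show ?thesis ..
  qed
  then obtain p where p: "P n (p n)" for n by metis
  define Y Z d e where "Y = (\<lambda>n. fst (p n))" and "Z = (\<lambda>n. fst (snd (p n)))"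
    and "d = (\<lambda>n. fst (snd (snd (p n))))" and "e = (\<lambda>n. snd (snd (snd (p n))))"
  have Pn: "P n (Y n, Z n, d n, e n)" for n
    using p[of n] by (simp add: Y_def Z_def d_def e_def)
  have "bounded (range Y)" "bounded (range Z)"
    using Pn by (auto simp: P_def intro!: bounded_range_matrix[of _ C])
  then have "bounded (range Y \<times> range Z)" by (rule bounded_Times)
  then have "bounded (range (\<lambda>n. (Y n, Z n)))" by (rule bounded_subset) auto
  from bounded_imp_convergent_subsequence[OF this]
  obtain yz \<rho> where \<rho>: "strict_mono \<rho>" and lim': "((\<lambda>n. (Y n, Z n)) \<circ> \<rho>) \<longlonglongrightarrow> yz"
    by blast
  obtain y z where "yz = (y, z)" by fastforce
  with lim' have lim: "((\<lambda>n. (Y n, Z n)) \<circ> \<rho>) \<longlonglongrightarrow> (y, z)" by simp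
  have Y: "(\<lambda>n. Y (\<rho> n)) \<longlonglongrightarrow> y" and Z: "(\<lambda>n. Z (\<rho> n)) \<longlonglongrightarrow> z"
    using tendsto_fst[OF lim] tendsto_snd[OF lim] by (simp_all add: o_def)
  have "(\<lambda>n. det (Y (\<rho> n))) \<longlonglongrightarrow> det y" "(\<lambda>n. det (Z (\<rho> n))) \<longlonglongrightarrow> det z"
    unfolding det_idx2 det_idx3 by (intro tendsto_intros Y Z)+
  moreover have "det (Y n) = 1" "det (Z n) = 1" for n
    using Pn[of n] by (auto simp: P_def)
  ultimately have det: "det y = 1" "det z = 1"
    by (simp_all add: LIMSEQ_const_iff)
  define N where "N = (\<lambda>n i j k l. norm (d (\<rho> n) i * d (\<rho> n) j * e (\<rho> n) k * e (\<rho> n) l))"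
  have "eventually (\<lambda>n. sub_tensor T y z i j k l \<noteq> 0 \<longrightarrow> N n i j k l < 1) sequentially" for i j k l
  proof (cases "sub_tensor T y z i j k l = 0")
    case False
    define c where "c = norm (sub_tensor T y z i j k l)"
    have "c > 0" using False by (simp add: c_def)
    have "(\<lambda>n. norm (sub_tensor T (Y (\<rho> n)) (Z (\<rho> n)) i j k l)) \<longlonglongrightarrow> c"
      unfolding c_def sub_tensor_def by (intro tendsto_norm tendsto_form tendsto_vec_nth Y Z)
    then have 1: "eventually (\<lambda>n. norm (sub_tensor T (Y (\<rho> n)) (Z (\<rho> n)) i j k l) > c / 2) sequentially"
      by (rule order_tendstoD) (use \<open>c > 0\<close> in simp)
    have "(\<lambda>n. 36 * C ^ 4 * (1 / Suc n)) \<longlonglongrightarrow> 36 * C ^ 4 * 0"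
      by (intro tendsto_mult tendsto_const LIMSEQ_Suc[OF lim_1_over_n])
    from LIMSEQ_subseq_LIMSEQ[OF this \<rho>]
    have "(\<lambda>n. 36 * C ^ 4 * (1 / Suc (\<rho> n))) \<longlonglongrightarrow> 0"
      by (simp only: o_def mult_zero_right)
    then have 2: "eventually (\<lambda>n. 36 * C ^ 4 * (1 / Suc (\<rho> n)) < c / 2) sequentially"
      by (rule order_tendstoD) (use \<open>c > 0\<close> in simp)
    from 1 2 show ?thesis
    proof eventually_elim
      case (elim n)
      \<comment> \<open>Here \<open>S > c / 2\<close> while \<open>N n i j k l * S < c / 2\<close>,
        so the diagonal factor has modulus below 1.\<close>
      define S where "S = norm (sub_tensor T (Y (\<rho> n)) (Z (\<rho> n)) i j k l)"
      have "N n i j k l * S \<le> 36 * C ^ 4 * (1 / Suc (\<rho> n))"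
        using Pn[of "\<rho> n"] by (auto simp: P_def N_def S_def norm_mult)
      then have "N n i j k l * S < S" using elim unfolding S_def by linarith
      moreover have "S > 0" using elim \<open>c > 0\<close> unfolding S_def by linarith
      ultimately show ?case by simp
    qed
  qed simp
  then have "eventually (\<lambda>n. \<forall>i j k l. sub_tensor T y z i j k l \<noteq> 0 \<longrightarrow> N n i j k l < 1) sequentially"
    by (intro eventually_all_finite)
  \<comment> \<open>One index serves all nonzero coefficients, there being finitely many, so the
    diagonal matrices at this \<open>n\<close> give the weights.\<close>
  then obtain n where n: "\<And>i j k l. sub_tensor T y z i j k l \<noteq> 0 \<Longrightarrow> N n i j k l < 1"
    using eventually_happens'[OF sequentially_bot] by blast
  define d' e' where "d' = d (\<rho> n)" and "e' = e (\<rho> n)"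
  have prod: "d' 0 * d' 1 = 1" "e' 0 * e' 1 * e' 2 = 1"
    using Pn[of "\<rho> n"] by (simp_all add: P_def d'_def e'_def)
  have "d' i \<noteq> 0" for i using prod(1) forall_idx2[of "\<lambda>i. d' i \<noteq> 0"] by auto
  moreover have "e' i \<noteq> 0" for i using prod(2) forall_idx3[of "\<lambda>i. e' i \<noteq> 0"] by auto
  ultimately have nz: "norm (d' i) > 0" "norm (e' k) > 0" for i k by auto
  define r s where "r = (\<lambda>i. - ln (norm (d' i)))" and "s = (\<lambda>k. - ln (norm (e' k)))"
  have "ln (norm (d' 0 * d' 1)) = 0" "ln (norm (e' 0 * e' 1 * e' 2)) = 0"
    unfolding prod by simp_all
  then have "r 0 + r 1 = 0" "s 0 + s 1 + s 2 = 0"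
    using nz by (simp_all add: r_def s_def norm_mult ln_mult)
  moreover have "r i + r j + s k + s l > 0" if "sub_tensor T y z i j k l \<noteq> 0" for i j k l
  proof -
    have "ln (norm (d' i) * norm (d' j) * norm (e' k) * norm (e' l)) < 0"
      using n[OF that] nz by (intro ln_less_zero) (auto simp: N_def norm_mult d'_def e'_def)
    then show ?thesis using nz by (simp add: r_def s_def ln_mult)
  qed
  ultimately show ?thesis using det by blast
qed

section \<open>Supports of tensors\<close>

text \<open>The monomial belonging to a tensor entry. Indices may coincide, and several quadruples
  may give the same monomial.\<close>

definition index_monomial :: "2 \<Rightarrow> 2 \<Rightarrow> 3 \<Rightarrow> 3 \<Rightarrow> monomial" where
  "index_monomial i j k l = ((\<chi> a. of_bool (a = i) + of_bool (a = j)), (\<chi> a. of_bool (a = k) + of_bool (a = l)))"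

definition supported :: "monomial set \<Rightarrow> (2 \<Rightarrow> 2 \<Rightarrow> 3 \<Rightarrow> 3 \<Rightarrow> complex) \<Rightarrow> bool" where
  "supported E T \<longleftrightarrow> (\<forall>i j k l. T i j k l \<noteq> 0 \<longrightarrow> index_monomial i j k l \<in> E)"

text \<open>The linear functional of \<open>Mplus\<close> read off from indices instead of
  exponents; membership becomes a check over 36 quadruples.\<close>

definition wt :: "int \<times> int \<Rightarrow> int \<times> int \<times> int \<Rightarrow> 2 \<Rightarrow> 2 \<Rightarrow> 3 \<Rightarrow> 3 \<Rightarrow> int" where
  "wt = (\<lambda>(r0, r1) (s0, s1, s2) i j k l.
    let r = (\<lambda>i. if i = 0 then r0 else r1); s = (\<lambda>k. if k = 0 then s0 else if k = 1 then s1 else s2)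
    in r i + r j + s k + s l)"

lemma index_monomial_in_M: "index_monomial i j k l \<in> M"
proof -
  have "(\<Sum>a\<in>UNIV. of_bool (a = i) + of_bool (a = j)) = (2::nat)" for i j :: 2
    by (simp add: sum.distrib)
  moreover have "(\<Sum>a\<in>UNIV. of_bool (a = i) + of_bool (a = j)) = (2::nat)" for i j :: 3
    by (simp add: sum.distrib)
  ultimately show ?thesis
    unfolding sum_idx2 sum_idx3 by (simp add: M_def index_monomial_def)
qed

lemma index_monomial_in_Mplus_iff: "index_monomial i j k l \<in> Mplus r s \<longleftrightarrow> wt r s i j k l > 0"
proof -
  obtain r0 r1 s0 s1 s2 where "r = (r0, r1)" "s = (s0, s1, s2)" by (metis surj_pair)
  moreover have "\<forall>i j k l. index_monomial i j k l \<in> Mplus (r0, r1) (s0, s1, s2) \<longleftrightarrow> wt (r0, r1) (s0, s1, s2) i j k l > 0"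
    using index_monomial_in_M unfolding forall_idx2 forall_idx3
    by (simp add: Mplus_def index_monomial_def wt_def) (intro conjI iffI; linarith)
  ultimately show ?thesis by simp
qed

lemma M_index_monomial:
  assumes "m \<in> M"
  shows "\<exists>i j k l. m = index_monomial i j k l"
proof -
  obtain \<alpha> \<beta> where m: "m = (\<alpha>, \<beta>)" by fastforce
  then have sums: "\<alpha>$0 + \<alpha>$1 = 2" "\<beta>$0 + \<beta>$1 + \<beta>$2 = 2"
    using assms by (auto simp: M_def)
  define e2 :: "2 \<Rightarrow> 2 \<Rightarrow> nat^2" where "e2 = (\<lambda>i j. \<chi> a. of_bool (a = i) + of_bool (a = j))"
  define e3 :: "3 \<Rightarrow> 3 \<Rightarrow> nat^3" where "e3 = (\<lambda>k l. \<chi> a. of_bool (a = k) + of_bool (a = l))"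
  have cases_le_2: "n = 0 \<or> n = 1 \<or> n = 2 \<or> n > 2" for n :: nat by linarith
  have "\<alpha> = e2 0 0 \<or> \<alpha> = e2 0 1 \<or> \<alpha> = e2 1 1"
    using sums(1) cases_le_2[of "\<alpha>$0"] unfolding vec_eq_iff forall_idx2
    by (elim disjE) (simp_all add: e2_def)
  moreover have "\<beta> = e3 0 0 \<or> \<beta> = e3 0 1 \<or> \<beta> = e3 0 2 \<or> \<beta> = e3 1 1 \<or> \<beta> = e3 1 2 \<or> \<beta> = e3 2 2"
    using sums(2) cases_le_2[of "\<beta>$0"] cases_le_2[of "\<beta>$1"] unfolding vec_eq_iff forall_idx3
    by (elim disjE) (simp_all add: e3_def)
  ultimately show ?thesis unfolding m index_monomial_def e2_def e3_def by blast
qed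

lemma monomial_fun_index_monomial: "monomial_fun (index_monomial i j k l) (x, y) = x$i * x$j * y$k * y$l"
proof -
  have "\<forall>i j k l. monomial_fun (index_monomial i j k l) (x, y) = x$i * x$j * y$k * y$l"
    unfolding forall_idx2 forall_idx3 by (simp add: index_monomial_def power2_eq_square)
  then show ?thesis by simp
qed

lemma lin_combs_sum:
  assumes "\<And>i. i \<in> I \<Longrightarrow> f i \<in> lin_combs E"
  shows "(\<lambda>p. \<Sum>i\<in>I. f i p) \<in> lin_combs E"
proof -
  obtain c where c: "\<And>i. i \<in> I \<Longrightarrow> f i = (\<lambda>p. \<Sum>m\<in>E. c i m * monomial_fun m p)"
    using assms unfolding lin_combs_def mem_Collect_eq by metis
  have "(\<Sum>i\<in>I. f i p) = (\<Sum>m\<in>E. (\<Sum>i\<in>I. c i m) * monomial_fun m p)" for p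
    using c sum.swap[of "\<lambda>i m. c i m * monomial_fun m p" E I] by (simp add: sum_distrib_right)
  then show ?thesis
    unfolding lin_combs_def mem_Collect_eq by (intro exI[of _ "\<lambda>m. \<Sum>i\<in>I. c i m"]) simp
qed

lemma lin_combs_term:
  assumes "finite E" "c \<noteq> 0 \<Longrightarrow> m \<in> E"
  shows "(\<lambda>p. c * monomial_fun m p) \<in> lin_combs E"
  unfolding lin_combs_def mem_Collect_eq
proof (intro exI ext)
  fix p show "c * monomial_fun m p = (\<Sum>m'\<in>E. (if m' = m then c else 0) * monomial_fun m' p)"
    using assms by (auto simp: if_distrib[of "\<lambda>x. x * _"] cong: if_cong)
qed

lemma tensor_fun_in_lin_combs:
  assumes "finite E" "supported E T"
  shows "tensor_fun T \<in> lin_combs E"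
proof -
  have "tensor_fun T = (\<lambda>p. \<Sum>i\<in>UNIV. \<Sum>j\<in>UNIV. \<Sum>k\<in>UNIV. \<Sum>l\<in>UNIV. T i j k l * monomial_fun (index_monomial i j k l) p)"
    by (simp add: fun_eq_iff tensor_fun_def form_def monomial_fun_index_monomial mult.assoc)
  also have "\<dots> \<in> lin_combs E"
    using assms by (intro lin_combs_sum lin_combs_term) (auto simp: supported_def)
  finally show ?thesis .
qed

lemma form_add_tensor:
  "form (\<lambda>i j k l. S i j k l + T i j k l) u u' w w' = form S u u' w w' + form T u u' w w'"
  by (simp add: form_def algebra_simps sum.distrib)

lemma form_scale_tensor:
  "form (\<lambda>i j k l. c * T i j k l) u u' w w' = c * form T u u' w w'"
  by (simp add: form_def sum_distrib_left mult.assoc)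

text \<open>Each monomial is first represented by a single entry; averaging over the four
  combinations of swaps within the two pairs then makes the tensor symmetric without changing the
  function.\<close>

lemma V_symmetric_tensor:
  assumes "h \<in> V"
  shows "\<exists>T. sym_tensor T \<and> h = tensor_fun T"
proof -
  obtain c where h: "h = (\<lambda>p. \<Sum>m\<in>M. c m * monomial_fun m p)"
    using assms by (auto simp: V_def lin_combs_def)
  have "\<exists>T. (\<lambda>p. \<Sum>m\<in>N. c m * monomial_fun m p) = tensor_fun T" if "finite N" "N \<subseteq> M" for N
    using that
  proof (induction N)
    case empty
    show ?case
      by (rule exI[of _ "\<lambda>i j k l. 0"]) (auto simp: tensor_fun_def form_def)
  next
    case (insert m N)
    then obtain T i j k l where T: "(\<lambda>p. \<Sum>m\<in>N. c m * monomial_fun m p) = tensor_fun T"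
      and m: "m = index_monomial i j k l"
      using M_index_monomial by blast
    define S where "S = (\<lambda>i' j' k' l'. if i' = i then if j' = j then if k' = k then if l' = l then 1 else 0 else 0 else 0 else 0 :: complex)"
    have "form S x x y y = monomial_fun m (x, y)" for x y
      unfolding m monomial_fun_index_monomial
      by (simp add: form_def S_def if_distrib[of "\<lambda>x. x * _"] sum_if_const cong: if_cong)
    then have "(\<lambda>p. \<Sum>m\<in>insert m N. c m * monomial_fun m p) = tensor_fun (\<lambda>i j k l. c m * S i j k l + T i j k l)"
      using insert.hyps T by (auto simp: fun_eq_iff tensor_fun_def form_add_tensor form_scale_tensor)
    then show ?case by (rule exI[of _ "\<lambda>i j k l. c m * S i j k l + T i j k l"])
  qed
  then obtain T where T: "h = tensor_fun T" using h finite_M by blast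
  define S where "S = (\<lambda>i j k l. 1/4 * (T i j k l + (T j i k l + (T i j l k + T j i l k))))"
  have "form S x x y y = form T x x y y" for x y
    unfolding S_def form_scale_tensor form_add_tensor
    by (simp add: form_swap[of T] form_swap(2)[of "\<lambda>i j k l. T j i k l"])
  then have "h = tensor_fun S" unfolding T by (simp add: tensor_fun_def)
  moreover have "sym_tensor S" by (simp add: sym_tensor_def S_def)
  ultimately show ?thesis by blast
qed

section \<open>Reduction to four weight systems\<close>

text \<open>Invertible matrices replace unimodular ones, since a common scaling of the rows
  preserves supports; this admits row permutations of determinant -1.\<close>

definition reducible_into :: "monomial set \<Rightarrow> (2 \<Rightarrow> 2 \<Rightarrow> 3 \<Rightarrow> 3 \<Rightarrow> complex) \<Rightarrow> bool" where
  "reducible_into E T \<longleftrightarrow> (\<exists>A B. det A \<noteq> 0 \<and> det B \<noteq> 0 \<and> supported E (sub_tensor T A B))"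

lemma reducible_into_sub_tensor:
  assumes "reducible_into E (sub_tensor T A B)" "det A \<noteq> 0" "det B \<noteq> 0"
  shows "reducible_into E T"
proof -
  obtain C D where "det C \<noteq> 0" "det D \<noteq> 0" "supported E (sub_tensor T (C ** A) (D ** B))"
    using assms(1) unfolding reducible_into_def sub_tensor_mult by blast
  then show ?thesis
    using assms(2,3) unfolding reducible_into_def by (metis det_mul mult_eq_0_iff)
qed

lemma mat_1_row: "mat 1 $ i = axis i 1"
  by (simp add: mat_def axis_def vec_eq_iff)

lemma sub_tensor_mat_1: "sub_tensor T (mat 1) (mat 1) = T"
  by (simp add: sub_tensor_def mat_1_row form_axis)

lemma supported_imp_reducible_into: "supported E T \<Longrightarrow> reducible_into E T"
  unfolding reducible_into_def by (metis det_I sub_tensor_mat_1 zero_neq_one)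

section \<open>Removing a square by a change of basis\<close>

lemma binary_quadratic_root:
  fixes p q r :: complex
  shows "\<exists>a b c d. p * a^2 + q * a * b + r * b^2 = 0 \<and> a * d - b * c = 1"
proof (cases "p = 0")
  case True
  then show ?thesis by (intro exI[of _ 1] exI[of _ 0]) simp
next
  case False
  \<comment> \<open>The quadratic formula in the chart \<open>b = 1\<close>; \<open>c = -1\<close>,
    \<open>d = 0\<close> complete \<open>a, b\<close> to a unimodular matrix. For
    \<open>p = 0\<close> the vector (1, 0) is a root.\<close>
  define a where "a = (csqrt (q^2 - 4 * p * r) - q) / (2 * p)"
  have "(2 * p * a + q)^2 = q^2 - 4 * p * r" using False by (simp add: a_def)
  then have "4 * p * (p * a^2 + q * a * 1 + r * 1^2) = 0" by (simp add: power2_eq_square algebra_simps)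
  then have "p * a^2 + q * a * 1 + r * 1^2 = 0" using False by simp
  moreover have "a * 0 - 1 * (-1) = (1::complex)" by simp
  ultimately show ?thesis by blast
qed

text \<open>Of the monomials left by \<open>zero\<close>, only x0 x1 y1^2 lies outside the target
  set. A change of basis in y1, y2 removes it and preserves the vanishing in
  \<open>zero\<close>.\<close>

lemma kill_square_in_y:
  assumes T: "sym_tensor T"
    and zero: "\<And>k l. T 0 0 k l = 0" "\<And>l. T 0 1 0 l = 0"
  shows "reducible_into (Mplus (-3, 3) (-2, -2, 4)) T"
proof -
  \<comment> \<open>The middle coefficient is doubled because a symmetric tensor stores a mixed
    coefficient twice.\<close>
  obtain a b c d where root: "T 0 1 1 1 * a^2 + (2 * T 0 1 1 2) * a * b + T 0 1 2 2 * b^2 = 0"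
    and det: "a * d - b * c = 1"
    using binary_quadratic_root by blast
  define D :: "complex^3^3" where "D = (\<chi> k l. if k = 0 then of_bool (l = 0)
    else if l = 0 then 0 else if k = 1 then if l = 1 then a else b else if l = 1 then c else d)"
  define T' where "T' = sub_tensor T (mat 1) D"
  have T': "T' i j k l = (\<Sum>k'\<in>UNIV. \<Sum>l'\<in>UNIV. T i j k' l' * D$k$k' * D$l$l')" for i j k l
    by (simp add: T'_def sub_tensor_def form_def mat_def if_distrib[of "\<lambda>x. x * _"]
        if_distrib[of "\<lambda>x. _ * x"] sum_if_const cong: if_cong)
  have sym: "T i j k l = T i j l k" "T i j k l = T j i k l" for i j k l
    using T unfolding sym_tensor_def by metis+
  have zero': "T 0 1 k 0 = 0" for k using sym(1)[of 0 1 k 0] zero(2) by simp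
  have "T' 0 0 k l = 0" for k l by (simp add: T' zero)
  moreover have 01: "T' 0 1 0 l = 0" "T' 0 1 k 0 = 0" for k l
    by (simp_all add: T' sum_idx3 D_def zero zero')
  moreover have "T' 0 1 1 1 = 0"
    using root by (simp add: T' sum_idx3 D_def zero zero' sym(1)[of 0 1 2 1] power2_eq_square algebra_simps)
  moreover have "T' 1 0 k l = T' 0 1 k l" for k l
    using sym_sub_tensor[OF T] unfolding T'_def sym_tensor_def by blast
  ultimately have "supported (Mplus (-3, 3) (-2, -2, 4)) T'"
    unfolding supported_def index_monomial_in_Mplus_iff forall_idx2 forall_idx3 by (simp add: wt_def)
  moreover have "det D \<noteq> 0" using det by (simp add: det_idx3 D_def)
  ultimately show ?thesis
    unfolding reducible_into_def T'_def by (metis det_I zero_neq_one)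
qed

text \<open>All monomials left by \<open>zero\<close> are divisible by y2, and of these only x0^2 y0
  y2 lies outside the target set. It disappears once x0 is chosen along a root of the binary form
  multiplying y0 y2.\<close>

lemma kill_square_in_x:
  assumes T: "sym_tensor T"
    and zero: "\<And>i j k l. k \<noteq> 2 \<Longrightarrow> l \<noteq> 2 \<Longrightarrow> T i j k l = 0"
  shows "reducible_into (Mplus (-2, 2) (-5, -1, 6)) T"
proof -
  obtain a b c d where root: "T 0 0 0 2 * a^2 + (2 * T 0 1 0 2) * a * b + T 1 1 0 2 * b^2 = 0"
    and det: "a * d - b * c = 1"
    using binary_quadratic_root by blast
  define C :: "complex^2^2" where "C = (\<chi> i j. if i = 0 then if j = 0 then a else b
    else if j = 0 then c else d)"
  define T' where "T' = sub_tensor T C (mat 1)"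
  have T': "T' i j k l = (\<Sum>i'\<in>UNIV. \<Sum>j'\<in>UNIV. T i' j' k l * C$i$i' * C$j$j')" for i j k l
    by (simp add: T'_def sub_tensor_def form_def mat_def if_distrib[of "\<lambda>x. x * _"]
        if_distrib[of "\<lambda>x. _ * x"] sum_if_const cong: if_cong)
  have sym: "T i j k l = T j i k l" for i j k l
    using T unfolding sym_tensor_def by metis
  have "T' i j k l = 0" if "k \<noteq> 2" "l \<noteq> 2" for i j k l
    by (simp add: T' zero that)
  moreover have "T' 0 0 0 2 = 0"
    using root by (simp add: T' sum_idx2 C_def sym[of 1 0] power2_eq_square algebra_simps)
  moreover have "T' 0 0 2 0 = T' 0 0 0 2"
    using sym_sub_tensor[OF T] unfolding T'_def sym_tensor_def by blast
  ultimately have "supported (Mplus (-2, 2) (-5, -1, 6)) T'"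
    unfolding supported_def index_monomial_in_Mplus_iff forall_idx2 forall_idx3 by (simp add: wt_def)
  moreover have "det C \<noteq> 0" using det by (simp add: det_idx2 C_def)
  ultimately show ?thesis
    unfolding reducible_into_def T'_def by (metis det_I zero_neq_one)
qed

lemma reducible_sorted:
  fixes r :: "2 \<Rightarrow> real" and s :: "3 \<Rightarrow> real"
  assumes T: "sym_tensor T"
    and r: "r 0 \<le> r 1" "r 0 + r 1 = 0" and s: "s 0 \<le> s 1" "s 1 \<le> s 2" "s 0 + s 1 + s 2 = 0"
    and pos: "\<And>i j k l. T i j k l \<noteq> 0 \<Longrightarrow> r i + r j + s k + s l > 0"
  shows "reducible_into (Mplus (-3, 3) (-2, -2, 4)) T \<or>
    reducible_into (Mplus (-4, 4) (-10, 5, 5)) T \<or>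
    reducible_into (Mplus (-2, 2) (-5, -1, 6)) T"
proof -
  define a where "a = r 1"
  have r': "r 1 = a" "r 0 = - a" "a \<ge> 0" using r by (auto simp: a_def)
  have zero: "T i j k l = 0" if "r i + r j + s k + s l \<le> 0" for i j k l
    using pos[of i j k l] that by linarith
  have supp: "supported (Mplus R S) T"
    if "\<forall>i j k l. r i + r j + s k + s l \<le> 0 \<or> wt R S i j k l > 0" for R S
    using that pos unfolding supported_def index_monomial_in_Mplus_iff by (meson linorder_not_less)
  \<comment> \<open>With the sorting, the first three cases give nonpositive weight to the largest
    monomials outside the set in question: x0 x1 y1^2 and x0^2 y1 y2 in case 1; x0 x1 y0 y2 and x1^2
    y0^2 in case 2; x0 x1 y1^2, x1^2 y0 y1 and x0^2 y0 y2 in case 4. If \<open>s 1 < 0\<close> and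
    neither 4 nor B holds, then \<open>s 2 < 2 * a\<close>, which gives case 1.\<close>
  consider (1) "s 1 \<le> 0" "s 1 + s 2 \<le> 2 * a"
    | (2) "s 1 \<ge> 0" "a \<le> s 1 + s 2"
    | (4) "s 1 < 0" "s 0 + s 1 + 2 * a \<le> 0" "s 0 + s 2 \<le> 2 * a"
    | (A) "s 1 \<ge> 0" "a > s 1 + s 2"
    | (B) "s 1 < 0" "s 0 + s 2 > 2 * a"
    using s r' by linarith
  then show ?thesis
  proof cases
    case 1
    then have "supported (Mplus (-3, 3) (-2, -2, 4)) T"
      using s r' by (intro supp, unfold forall_idx2 forall_idx3) (simp add: wt_def; linarith)
    then show ?thesis using supported_imp_reducible_into by blast
  next
    case 2
    then have "supported (Mplus (-4, 4) (-10, 5, 5)) T"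
      using s r' by (intro supp, unfold forall_idx2 forall_idx3) (simp add: wt_def; linarith)
    then show ?thesis using supported_imp_reducible_into by blast
  next
    case 4
    then have "supported (Mplus (-2, 2) (-5, -1, 6)) T"
      using s r' by (intro supp, unfold forall_idx2 forall_idx3) (simp add: wt_def; linarith)
    then show ?thesis using supported_imp_reducible_into by blast
  next
    case A
    have le: "s k \<le> s 2" for k
      using forall_idx3[of "\<lambda>k. s k \<le> s 2"] s by auto
    \<comment> \<open>Here \<open>s 2 \<le> s 1 + s 2 < a\<close> excludes x0^2, and
      \<open>s 0 + s 2 = - s 1 \<le> 0\<close> excludes y0 from the coefficient of x0 x1.\<close>
    have "T 0 0 k l = 0" for k l
      using le[of k] le[of l] A s r' by (intro zero) linarith
    moreover have "T 0 1 0 l = 0" for l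
      using le[of l] A s r' by (intro zero) linarith
    ultimately show ?thesis using kill_square_in_y[OF T] by blast
  next
    case B
    have "s k \<le> s 1" if "k \<noteq> 2" for k
      using forall_idx3[of "\<lambda>k. k \<noteq> 2 \<longrightarrow> s k \<le> s 1"] s that by auto
    moreover have "r i \<le> a" for i
      using forall_idx2[of "\<lambda>i. r i \<le> a"] r' by auto
    \<comment> \<open>Since \<open>s 0 + s 2 = - s 1\<close>, case B says
      \<open>s 1 < - 2 * a\<close>, so the weight is at most \<open>2 * a + 2 * s 1\<close>, which
      is negative.\<close>
    ultimately have "T i j k l = 0" if "k \<noteq> 2" "l \<noteq> 2" for i j k l
      using that B s by (intro zero) (smt (verit))
    then show ?thesis using kill_square_in_x[OF T] by blast
  qed
qed

section \<open>Sorting the weights\<close>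

lemma ex_sorting_permutation2:
  fixes f :: "2 \<Rightarrow> real"
  shows "\<exists>\<pi>. \<pi> permutes UNIV \<and> f (\<pi> 0) \<le> f (\<pi> 1)"
proof (cases "f 0 \<le> f 1")
  case True
  then show ?thesis by (intro exI[of _ id]) (simp add: permutes_id)
next
  case False
  then show ?thesis
    by (intro exI[of _ "Transposition.transpose 0 1"]) (simp add: permutes_swap_id)
qed

lemma ex_sorting_permutation3:
  fixes f :: "3 \<Rightarrow> real"
  shows "\<exists>\<pi>. \<pi> permutes UNIV \<and> f (\<pi> 0) \<le> f (\<pi> 1) \<and> f (\<pi> 1) \<le> f (\<pi> 2)"
proof -
  define p :: "3 \<Rightarrow> 3 \<Rightarrow> 3 \<Rightarrow> 3 \<Rightarrow> 3" where "p = (\<lambda>a b c i. if i = 0 then a else if i = 1 then b else c)"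
  have p: "p a b c 0 = a" "p a b c 1 = b" "p a b c 2 = c" for a b c
    by (simp_all add: p_def)
  have perm: "p a b c permutes UNIV" if "a \<noteq> b" "a \<noteq> c" "b \<noteq> c" for a b c
  proof -
    have "\<forall>i j. p a b c i = p a b c j \<longrightarrow> i = j"
      unfolding forall_idx3 p using that by simp
    then have "inj (p a b c)" by (simp add: inj_def)
    then show ?thesis by (intro bij_imp_permutes) (simp_all add: bij_def finite_UNIV_inj_surj)
  qed
  have "\<exists>a b c. a \<noteq> b \<and> a \<noteq> c \<and> b \<noteq> c \<and> f a \<le> f b \<and> f b \<le> f c"
  proof -
    consider "f 0 \<le> f 1 \<and> f 1 \<le> f 2" | "f 0 \<le> f 2 \<and> f 2 \<le> f 1" | "f 1 \<le> f 0 \<and> f 0 \<le> f 2"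
      | "f 1 \<le> f 2 \<and> f 2 \<le> f 0" | "f 2 \<le> f 0 \<and> f 0 \<le> f 1" | "f 2 \<le> f 1 \<and> f 1 \<le> f 0"
      by linarith
    moreover have "(0::3) \<noteq> 1" "(0::3) \<noteq> 2" "(1::3) \<noteq> 2" by simp_all
    ultimately show ?thesis by metis
  qed
  then obtain a b c where "a \<noteq> b" "a \<noteq> c" "b \<noteq> c" "f a \<le> f b" "f b \<le> f c" by blast
  then show ?thesis using perm p by metis
qed

lemma reducible_unstable:
  assumes T: "sym_tensor T" and "unstable (tensor_fun T)"
  shows "reducible_into (Mplus (-3, 3) (-2, -2, 4)) T \<or>
    reducible_into (Mplus (-4, 4) (-10, 5, 5)) T \<or>
    reducible_into (Mplus (-2, 2) (-5, -1, 6)) T"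
proof -
  obtain Y Z and r :: "2 \<Rightarrow> real" and s :: "3 \<Rightarrow> real" where YZ: "det Y = 1" "det Z = 1"
    and sums: "r 0 + r 1 = 0" "s 0 + s 1 + s 2 = 0"
    and pos: "\<And>i j k l. sub_tensor T Y Z i j k l \<noteq> 0 \<Longrightarrow> r i + r j + s k + s l > 0"
    using destabilising_weights[OF assms] by blast
  obtain \<pi> where \<pi>: "\<pi> permutes UNIV" "r (\<pi> 0) \<le> r (\<pi> 1)"
    using ex_sorting_permutation2 by blast
  obtain \<sigma> where \<sigma>: "\<sigma> permutes UNIV" "s (\<sigma> 0) \<le> s (\<sigma> 1)" "s (\<sigma> 1) \<le> s (\<sigma> 2)"
    using ex_sorting_permutation3 by blast
  \<comment> \<open>Permuting the rows permutes the weights in the same way and changes the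
    determinants at most by a sign.\<close>
  define Y' where "Y' = (\<chi> i. Y $ \<pi> i)"
  define Z' where "Z' = (\<chi> i. Z $ \<sigma> i)"
  have det: "det Y' \<noteq> 0" "det Z' \<noteq> 0"
    unfolding Y'_def Z'_def det_permute_rows[OF \<pi>(1)] det_permute_rows[OF \<sigma>(1)] YZ
    by (simp_all add: sign_def)
  have "(\<Sum>i\<in>UNIV. r (\<pi> i)) = (\<Sum>i\<in>UNIV. r i)" "(\<Sum>i\<in>UNIV. s (\<sigma> i)) = (\<Sum>i\<in>UNIV. s i)"
    by (rule sum.permute[OF \<pi>(1), symmetric, unfolded o_def] sum.permute[OF \<sigma>(1), symmetric, unfolded o_def])+
  then have "r (\<pi> 0) + r (\<pi> 1) = 0" "s (\<sigma> 0) + s (\<sigma> 1) + s (\<sigma> 2) = 0"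
    using sums by (simp_all add: sum_idx2 sum_idx3)
  moreover have "r (\<pi> i) + r (\<pi> j) + s (\<sigma> k) + s (\<sigma> l) > 0" if "sub_tensor T Y' Z' i j k l \<noteq> 0" for i j k l
    using pos that by (simp add: sub_tensor_def Y'_def Z'_def)
  ultimately show ?thesis
    using reducible_sorted[OF sym_sub_tensor[OF T], where r = "\<lambda>i. r (\<pi> i)" and s = "\<lambda>k. s (\<sigma> k)"] \<pi>(2) \<sigma>(2,3)
      reducible_into_sub_tensor[OF _ det] by blast
qed

section \<open>Return to the orbit under unimodular matrices\<close>

lemma reducible_into_imp_orbit:
  assumes "reducible_into E T" "finite E"
  shows "\<exists>f \<in> orbit (tensor_fun T). f \<in> lin_combs E"
proof -
  obtain A B where AB: "det A \<noteq> 0" "det B \<noteq> 0" and supp: "supported E (sub_tensor T A B)"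
    using assms(1) by (auto simp: reducible_into_def)
  \<comment> \<open>Scaling all rows by an inverse square root or cube root of the determinant makes
    it 1.\<close>
  define c where "c = inverse (csqrt (det A))"
  define e where "e = inverse (exp (Ln (det B) / 3))"
  have "c ^ 2 * det A = 1" using AB(1) by (simp add: c_def power_inverse)
  moreover have "exp (Ln (det B) / 3) ^ 3 = det B"
    using AB(2) exp_of_nat_mult[of 3 "Ln (det B) / 3"] by simp
  then have "e ^ 3 * det B = 1"
    using AB(2) by (simp only: e_def power_inverse) simp
  moreover define A' where "A' = (\<chi> i. c *s A$i)"
  moreover define B' where "B' = (\<chi> i. e *s B$i)"
  ultimately have "det A' = 1" "det B' = 1"
    by (simp_all add: det_idx2 det_idx3 power2_eq_square power3_eq_cube algebra_simps)
  then have "act (A', B') (tensor_fun T) \<in> orbit (tensor_fun T)"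
    unfolding orbit_def G_def by blast
  moreover have "act (A', B') (tensor_fun T) = tensor_fun (sub_tensor T A' B')"
    by (simp add: tensor_fun_def form_sub_tensor fun_eq_iff)
  moreover have "supported E (sub_tensor T A' B')"
    using supp by (simp add: supported_def sub_tensor_def A'_def B'_def form_scale)
  ultimately show ?thesis using tensor_fun_in_lin_combs[OF assms(2)] by metis
qed

theorem theorem7p1:
  fixes h :: "(complex^2) \<times> (complex^3) \<Rightarrow> complex"
  assumes "h \<in> V" and "h \<noteq> (\<lambda>_. 0)" and "unstable h"
  shows "(\<exists>f \<in> orbit h.
            f \<in> lin_combs (Mplus (-3, 3) (-2, -2, 4)) \<or>
            f \<in> lin_combs (Mplus (-4, 4) (-10, 5, 5)) \<or>
            f \<in> lin_combs (Mplus (-1, 1) (-3, -1, 4)) \<or>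
            f \<in> lin_combs (Mplus (-2, 2) (-5, -1, 6)))
       \<and> (\<forall>E \<in> set [Mplus (-3, 3) (-2, -2, 4), Mplus (-4, 4) (-10, 5, 5),
                     Mplus (-1, 1) (-3, -1, 4), Mplus (-2, 2) (-5, -1, 6)]. E \<subseteq> M)
       \<and> distinct [Mplus (-3, 3) (-2, -2, 4), Mplus (-4, 4) (-10, 5, 5),
                   Mplus (-1, 1) (-3, -1, 4), Mplus (-2, 2) (-5, -1, 6)]"
proof (intro conjI)
  obtain T where T: "sym_tensor T" "h = tensor_fun T"
    using V_symmetric_tensor[OF assms(1)] by blast
  have sub: "Mplus r s \<subseteq> M" for r s
    by (cases r; cases s) (auto simp: Mplus_def)
  then have fin: "finite (Mplus r s)" for r s
    using finite_M finite_subset by blast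
  show "\<exists>f \<in> orbit h.
            f \<in> lin_combs (Mplus (-3, 3) (-2, -2, 4)) \<or>
            f \<in> lin_combs (Mplus (-4, 4) (-10, 5, 5)) \<or>
            f \<in> lin_combs (Mplus (-1, 1) (-3, -1, 4)) \<or>
            f \<in> lin_combs (Mplus (-2, 2) (-5, -1, 6))"
    using reducible_unstable[OF T(1)] assms(3) reducible_into_imp_orbit[OF _ fin] unfolding T(2) by meson
  show "\<forall>E \<in> set [Mplus (-3, 3) (-2, -2, 4), Mplus (-4, 4) (-10, 5, 5),
                     Mplus (-1, 1) (-3, -1, 4), Mplus (-2, 2) (-5, -1, 6)]. E \<subseteq> M"
    using sub by simp
  \<comment> \<open>The separating monomials are x1^2 y0^2 for the first set, x0^2 y1^2 for the
    second, and x1^2 y1^2 for the last pair, where its weight in the third system is exactly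
    0.\<close>
  have neq: "Mplus r s \<noteq> Mplus r' s'" if "wt r s i j k l > 0" "\<not> wt r' s' i j k l > 0" for r s r' s' i j k l
    using that index_monomial_in_Mplus_iff by metis
  have "Mplus (-3, 3) (-2, -2, 4) \<noteq> Mplus (-4, 4) (-10, 5, 5)"
       "Mplus (-3, 3) (-2, -2, 4) \<noteq> Mplus (-1, 1) (-3, -1, 4)"
       "Mplus (-3, 3) (-2, -2, 4) \<noteq> Mplus (-2, 2) (-5, -1, 6)"
    by (rule neq[of _ _ 1 1 0 0]; simp add: wt_def)+
  moreover have "Mplus (-4, 4) (-10, 5, 5) \<noteq> Mplus (-1, 1) (-3, -1, 4)"
       "Mplus (-4, 4) (-10, 5, 5) \<noteq> Mplus (-2, 2) (-5, -1, 6)"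
    by (rule neq[of _ _ 0 0 1 1]; simp add: wt_def)+
  moreover have "Mplus (-2, 2) (-5, -1, 6) \<noteq> Mplus (-1, 1) (-3, -1, 4)"
    by (rule neq[of _ _ 1 1 1 1]; simp add: wt_def)
  ultimately show "distinct [Mplus (-3, 3) (-2, -2, 4), Mplus (-4, 4) (-10, 5, 5),
                   Mplus (-1, 1) (-3, -1, 4), Mplus (-2, 2) (-5, -1, 6)]"
    by simp
qed

end
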